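(* Let $n_1,n_2,m$ be positive integers with $n_2<n_1$. Let $M,D,K\in\mathbb{R}^{n_1\times n_1}$, $G\in\mathbb{R}^{n_2\times n_1}$ and $F\in\mathbb{R}^{n_1\times m}$, where $M$ and $GM^{-1}G^T$ are invertible, and set $$\Pi := I-G^T(GM^{-1}G^T)^{-1}GM^{-1}\in\mathbb{R}^{n_1\times n_1}.$$ Let $\alpha\in\mathbb{C}$ and $b\in\mathbb{C}^m$. Then $\varkappa\in\mathbb{C}^{n_1}$ satisfies both $$\varkappa=\Pi^T\varkappa \quad\text{and}\quad \Pi(\alpha^2 M+\alpha D+K)\Pi^T\varkappa=\Pi F b$$ if and only if there exists $\Lambda\in\mathbb{C}^{n_2}$ such that $$\begin{bmatrix}\alpha^2 M+\alpha D+K & G^T\\ G & 0\end{bmatrix}\begin{bmatrix}\varkappa\\ \Lambda\end{bmatrix}=\begin{bmatrix}F b\\ 0\end{bmatrix}.$$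
   Context: The matrices come from the second-order index-3 descriptor system $M\ddot{x}(t)+D\dot{x}(t)+Kx(t)+G^Tz(t)=Fu(t)$, $Gx(t)=0$, with mass, damping and stiffness matrices $M,D,K$, constraint matrix $G$ and input matrix $F$. The superscript $T$ denotes the (non-conjugate) transpose, and $I$ is the $n_1\times n_1$ identity matrix. The scalar $\alpha$ is an interpolation point and $b$ is a tangential direction. *)

theory Defs
  imports
    "HOL.Complex"
    "Jordan_Normal_Form.Gauss_Jordan_Elimination"
begin

text \<open>The inverse of an invertible square matrix over a field. It is unspecified otherwise, since
  \<^const>\<open>mat_inverse\<close> then returns \<^const>\<open>None\<close>.\<close>

definition mat_inv :: "'a :: field mat \<Rightarrow> 'a mat" where
  "mat_inv A = the (mat_inverse A)"

abbreviation complex_mat :: "real mat \<Rightarrow> complex mat" where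
  "complex_mat \<equiv> map_mat complex_of_real"

text \<open>For \<open>M\<close> and \<open>G M\<^sup>-\<^sup>1 G\<^sup>T\<close> invertible, this is the oblique projection \<open>\<Pi>\<close> along the range
  of \<open>G\<^sup>T\<close> onto the kernel of \<open>G M\<^sup>-\<^sup>1\<close>.\<close>

definition proj_mat :: "'a :: field mat \<Rightarrow> 'a mat \<Rightarrow> 'a mat" where
  "proj_mat M G =
     1\<^sub>m (dim_row M) -
     transpose_mat G * mat_inv (G * mat_inv M * transpose_mat G) * G * mat_inv M"

definition quad_pencil :: "real mat \<Rightarrow> real mat \<Rightarrow> real mat \<Rightarrow> complex \<Rightarrow> complex mat" where
  "quad_pencil M D K \<alpha> =
     \<alpha>\<^sup>2 \<cdot>\<^sub>m complex_mat M + \<alpha> \<cdot>\<^sub>m complex_mat D + complex_mat K"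

end

theory Submission
  imports Defs
begin

text \<open>The matrix \<open>\<Pi>\<close> has the form \<open>I - H V\<close> with \<open>H = G\<^sup>T\<close> and
  \<open>V = (G M\<^sup>-\<^sup>1 G\<^sup>T)\<^sup>-\<^sup>1 G M\<^sup>-\<^sup>1\<close>, a left inverse of \<open>H\<close>. From \<open>V H = I\<close> alone one reads off both

  \<^item> the kernel of \<open>I - H V\<close> is the range of \<open>H\<close> (\<open>one_minus_mult_kernel_iff\<close>), and
  \<^item> the fixed vectors of \<open>(I - H V)\<^sup>T = I - V\<^sup>T H\<^sup>T\<close> form the kernel of
    \<open>H\<^sup>T = G\<close> (\<open>one_minus_mult_fixed_iff\<close>).

  Write \<open>A\<close> for the pencil and \<open>f = F b\<close>. By the second fact, \<open>\<kappa> = \<Pi>\<^sup>T \<kappa>\<close> is the constraint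
  \<open>G \<kappa> = 0\<close>, which is the second block row. Given it, the projected equation reads
  \<open>\<Pi> (f - A \<kappa>) = 0\<close>, and by the first fact this means \<open>f - A \<kappa> = G\<^sup>T \<Lambda>\<close> for some \<open>\<Lambda>\<close>,
  which is the first block row. So \<open>\<Lambda>\<close> is the Lagrange multiplier that \<open>\<Pi>\<close> eliminates.
  The lemma \<open>projected_equation_iff_saddle_point\<close> carries this out for an arbitrary \<open>A\<close>.\<close>

lemma mat_inv:
  fixes A :: "'a :: field mat"
  assumes A: "A \<in> carrier_mat n n" and inv: "invertible_mat A"
  shows "mat_inv A \<in> carrier_mat n n"
    and "A * mat_inv A = 1\<^sub>m n"
    and "mat_inv A * A = 1\<^sub>m n"
proof -
  obtain B where AB: "A * B = 1\<^sub>m n" and "B * A = 1\<^sub>m (dim_row B)"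
    using A inv unfolding invertible_mat_def inverts_mat_def by auto
  have "dim_col B = n" using arg_cong[OF AB, of dim_col] by simp
  moreover have "dim_row B = n"
    using arg_cong[OF \<open>B * A = 1\<^sub>m (dim_row B)\<close>, of dim_col] A by simp
  ultimately have "A \<in> Units (ring_mat TYPE('a) n ())"
    using A AB \<open>B * A = 1\<^sub>m (dim_row B)\<close>
    unfolding Units_def ring_mat_def by (auto intro!: bexI[of _ B])
  then obtain C where C: "mat_inverse A = Some C"
    using mat_inverse(1)[OF A, of "()"] by (cases "mat_inverse A") auto
  then have "mat_inv A = C" by (simp add: mat_inv_def)
  with mat_inverse(2)[OF A C]
  show "mat_inv A \<in> carrier_mat n n" "A * mat_inv A = 1\<^sub>m n" "mat_inv A * A = 1\<^sub>m n"
    by auto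
qed

lemma one_minus_mult_mat_vec:
  fixes U V :: "'a :: comm_ring_1 mat"
  assumes "U \<in> carrier_mat n k" "V \<in> carrier_mat k n" "x \<in> carrier_vec n"
  shows "(1\<^sub>m n - U * V) *\<^sub>v x = x - U *\<^sub>v (V *\<^sub>v x)"
  using assms by (simp add: minus_mult_distrib_mat_vec[of _ n n])

lemma left_inverse_mult_mat_vec:
  fixes U V :: "'a :: comm_ring_1 mat"
  assumes "U \<in> carrier_mat n k" "V \<in> carrier_mat k n" "V * U = 1\<^sub>m k" "z \<in> carrier_vec k"
  shows "V *\<^sub>v (U *\<^sub>v z) = z"
  using assms assoc_mult_mat_vec[of V k n U k z] by simp

text \<open>A fixed vector satisfies \<open>U (V x) = 0\<close>, and \<open>U\<close> is injective because \<open>V\<close> inverts it on the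
  left. Below this is applied to \<open>V\<^sup>T\<close> and \<open>H\<^sup>T\<close> in place of \<open>U\<close> and \<open>V\<close>.\<close>

lemma one_minus_mult_fixed_iff:
  fixes U V :: "'a :: comm_ring_1 mat"
  assumes U: "U \<in> carrier_mat n k" and V: "V \<in> carrier_mat k n" and VU: "V * U = 1\<^sub>m k"
    and x: "x \<in> carrier_vec n"
  shows "x = (1\<^sub>m n - U * V) *\<^sub>v x \<longleftrightarrow> V *\<^sub>v x = 0\<^sub>v k"
proof
  assume fixed: "x = (1\<^sub>m n - U * V) *\<^sub>v x"
  have Vx: "V *\<^sub>v x \<in> carrier_vec k" using V x by (rule mult_mat_vec_carrier)
  have "V *\<^sub>v x = V *\<^sub>v (x - U *\<^sub>v (V *\<^sub>v x))"
    using fixed one_minus_mult_mat_vec[OF U V x] by simp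
  also have "\<dots> = V *\<^sub>v x - V *\<^sub>v (U *\<^sub>v (V *\<^sub>v x))"
    using U V x by (intro mult_minus_distrib_mat_vec) auto
  also have "\<dots> = V *\<^sub>v x - V *\<^sub>v x"
    by (simp only: left_inverse_mult_mat_vec[OF U V VU Vx])
  also have "\<dots> = 0\<^sub>v k" using Vx by auto
  finally show "V *\<^sub>v x = 0\<^sub>v k" .
next
  assume "V *\<^sub>v x = 0\<^sub>v k"
  moreover have "U *\<^sub>v 0\<^sub>v k = 0\<^sub>v n" using U by auto
  ultimately show "x = (1\<^sub>m n - U * V) *\<^sub>v x"
    using one_minus_mult_mat_vec[OF U V x] x by simp
qed

text \<open>A vector \<open>y\<close> in the kernel is \<open>U z\<close> with the explicit witness \<open>z = V y\<close>.\<close>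

lemma one_minus_mult_kernel_iff:
  fixes U V :: "'a :: comm_ring_1 mat"
  assumes U: "U \<in> carrier_mat n k" and V: "V \<in> carrier_mat k n" and VU: "V * U = 1\<^sub>m k"
    and y: "y \<in> carrier_vec n"
  shows "(1\<^sub>m n - U * V) *\<^sub>v y = 0\<^sub>v n \<longleftrightarrow> (\<exists>z \<in> carrier_vec k. y = U *\<^sub>v z)"
proof
  assume "(1\<^sub>m n - U * V) *\<^sub>v y = 0\<^sub>v n"
  then have diff: "y - U *\<^sub>v (V *\<^sub>v y) = 0\<^sub>v n"
    by (simp add: one_minus_mult_mat_vec[OF U V y])
  have "y = U *\<^sub>v (V *\<^sub>v y)"
  proof (rule eq_vecI)
    fix i assume "i < dim_vec (U *\<^sub>v (V *\<^sub>v y))"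
    then show "y $ i = (U *\<^sub>v (V *\<^sub>v y)) $ i"
      using arg_cong[OF diff, of "\<lambda>v. v $ i"] U y by simp
  qed (use U y in simp)
  then show "\<exists>z \<in> carrier_vec k. y = U *\<^sub>v z"
    using mult_mat_vec_carrier[OF V y] by blast
next
  assume "\<exists>z \<in> carrier_vec k. y = U *\<^sub>v z"
  then obtain z where z: "z \<in> carrier_vec k" and yz: "y = U *\<^sub>v z" by blast
  have "V *\<^sub>v y = z"
    unfolding yz by (rule left_inverse_mult_mat_vec[OF U V VU z])
  then show "(1\<^sub>m n - U * V) *\<^sub>v y = 0\<^sub>v n"
    using one_minus_mult_mat_vec[OF U V y] yz y by simp
qed

text \<open>Here \<open>z\<close> collects the Lagrange multipliers of the constraint \<open>H\<^sup>T x = 0\<close>: the residual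
  \<open>f - A x\<close> is annihilated by the projection exactly when it is of the form \<open>H z\<close>.\<close>

lemma projected_equation_iff_saddle_point:
  fixes A H V :: "'a :: comm_ring_1 mat"
  assumes A: "A \<in> carrier_mat n n"
    and H: "H \<in> carrier_mat n k" and V: "V \<in> carrier_mat k n" and VH: "V * H = 1\<^sub>m k"
    and x: "x \<in> carrier_vec n" and f: "f \<in> carrier_vec n"
    and P: "P = 1\<^sub>m n - H * V"
  shows "x = transpose_mat P *\<^sub>v x \<and> (P * A * transpose_mat P) *\<^sub>v x = P *\<^sub>v f \<longleftrightarrow>
    (\<exists>z \<in> carrier_vec k.
       four_block_mat A H (transpose_mat H) (0\<^sub>m k k) *\<^sub>v (x @\<^sub>v z) = f @\<^sub>v 0\<^sub>v k)"
proof -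
  have Pc: "P \<in> carrier_mat n n" using H V P by auto
  have Ax: "A *\<^sub>v x \<in> carrier_vec n" using A x by (rule mult_mat_vec_carrier)
  \<comment> \<open>The transposed projection has the same shape, with \<open>H\<^sup>T\<close> as the left inverse of \<open>V\<^sup>T\<close>.\<close>
  have PT: "transpose_mat P = 1\<^sub>m n - transpose_mat V * transpose_mat H"
    unfolding P using H V by (simp add: transpose_minus[of _ n n] transpose_mult[of _ n k])
  have HV: "transpose_mat H * transpose_mat V = 1\<^sub>m k"
    using VH transpose_mult[OF V H] by simp
  have constraint: "x = transpose_mat P *\<^sub>v x \<longleftrightarrow> transpose_mat H *\<^sub>v x = 0\<^sub>v k"
    unfolding PT using H V x HV by (intro one_minus_mult_fixed_iff) auto
  have residual: "P *\<^sub>v (A *\<^sub>v x) = P *\<^sub>v f \<longleftrightarrow>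
      (\<exists>z \<in> carrier_vec k. A *\<^sub>v x + H *\<^sub>v z = f)"
  proof -
    have shift: "f - A *\<^sub>v x = w \<longleftrightarrow> A *\<^sub>v x + w = f" if "w \<in> carrier_vec n" for w
      using that Ax f A by (auto simp: vec_eq_iff diff_eq_eq add.commute)
    have "P *\<^sub>v (A *\<^sub>v x) = P *\<^sub>v f \<longleftrightarrow> P *\<^sub>v (f - A *\<^sub>v x) = 0\<^sub>v n"
      unfolding mult_minus_distrib_mat_vec[OF Pc f Ax]
      using Pc by (auto simp: vec_eq_iff)
    also have "\<dots> \<longleftrightarrow> (\<exists>z \<in> carrier_vec k. f - A *\<^sub>v x = H *\<^sub>v z)"
      unfolding P using f Ax by (intro one_minus_mult_kernel_iff[OF H V VH]) auto
    also have "\<dots> \<longleftrightarrow> (\<exists>z \<in> carrier_vec k. A *\<^sub>v x + H *\<^sub>v z = f)"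
      using H by (intro bex_cong refl shift) auto
    finally show ?thesis .
  qed
  have assoc: "(P * A * transpose_mat P) *\<^sub>v x = P *\<^sub>v (A *\<^sub>v (transpose_mat P *\<^sub>v x))"
    using Pc A x by (simp add: assoc_mult_mat_vec[of _ n n _ n])
  have block: "four_block_mat A H (transpose_mat H) (0\<^sub>m k k) *\<^sub>v (x @\<^sub>v z) = f @\<^sub>v 0\<^sub>v k \<longleftrightarrow>
      A *\<^sub>v x + H *\<^sub>v z = f \<and> transpose_mat H *\<^sub>v x = 0\<^sub>v k"
    if z: "z \<in> carrier_vec k" for z
  proof -
    have "four_block_mat A H (transpose_mat H) (0\<^sub>m k k) *\<^sub>v (x @\<^sub>v z) =
        (A *\<^sub>v x + H *\<^sub>v z) @\<^sub>v (transpose_mat H *\<^sub>v x + 0\<^sub>m k k *\<^sub>v z)"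
      using A H x z by (intro four_block_mat_mult_vec) auto
    moreover have "transpose_mat H *\<^sub>v x + 0\<^sub>m k k *\<^sub>v z = transpose_mat H *\<^sub>v x"
      using H z by auto
    moreover have "A *\<^sub>v x + H *\<^sub>v z \<in> carrier_vec n"
      using Ax mult_mat_vec_carrier[OF H z] by simp
    ultimately show ?thesis using f by (simp add: append_vec_eq[of _ n])
  qed
  have "x = transpose_mat P *\<^sub>v x \<and> (P * A * transpose_mat P) *\<^sub>v x = P *\<^sub>v f \<longleftrightarrow>
      x = transpose_mat P *\<^sub>v x \<and> P *\<^sub>v (A *\<^sub>v x) = P *\<^sub>v f"
    unfolding assoc by auto
  also have "\<dots> \<longleftrightarrow> transpose_mat H *\<^sub>v x = 0\<^sub>v k \<and>
      (\<exists>z \<in> carrier_vec k. A *\<^sub>v x + H *\<^sub>v z = f)"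
    by (simp only: constraint residual)
  also have "\<dots> \<longleftrightarrow> (\<exists>z \<in> carrier_vec k.
      four_block_mat A H (transpose_mat H) (0\<^sub>m k k) *\<^sub>v (x @\<^sub>v z) = f @\<^sub>v 0\<^sub>v k)"
    using block by blast
  finally show ?thesis .
qed

lemma proj_mat_eq_one_minus_mult:
  fixes M G :: "'a :: field mat"
  assumes M: "M \<in> carrier_mat n n" and G: "G \<in> carrier_mat k n"
    and M_inv: "invertible_mat M"
    and S_inv: "invertible_mat (G * mat_inv M * transpose_mat G)"
  obtains V where "V \<in> carrier_mat k n" and "V * transpose_mat G = 1\<^sub>m k"
    and "proj_mat M G = 1\<^sub>m n - transpose_mat G * V"
proof
  define N where "N = mat_inv M"
  define S where "S = G * N * transpose_mat G"
  define W where "W = mat_inv S"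
  have N: "N \<in> carrier_mat n n" unfolding N_def using M M_inv by (rule mat_inv)
  have S: "S \<in> carrier_mat k k" unfolding S_def using G N by auto
  have W: "W \<in> carrier_mat k k" and WS: "W * S = 1\<^sub>m k"
    using mat_inv[OF S] S_inv unfolding S_def N_def W_def by auto
  have GT: "transpose_mat G \<in> carrier_mat n k" using G by simp
  have GN: "G * N \<in> carrier_mat k n" using G N by simp
  show "W * (G * N) \<in> carrier_mat k n" using W GN by simp
  show "W * (G * N) * transpose_mat G = 1\<^sub>m k"
    using assoc_mult_mat[OF W GN GT] WS unfolding S_def by simp
  have "transpose_mat G * W * G * N = transpose_mat G * W * (G * N)"
    by (rule assoc_mult_mat[OF mult_carrier_mat[OF GT W] G N])
  also have "\<dots> = transpose_mat G * (W * (G * N))"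
    by (rule assoc_mult_mat[OF GT W GN])
  finally show "proj_mat M G = 1\<^sub>m n - transpose_mat G * (W * (G * N))"
    unfolding proj_mat_def W_def S_def N_def using M by simp
qed

lemma complex_mat_minus:
  assumes "A \<in> carrier_mat nr nc" "B \<in> carrier_mat nr nc"
  shows "complex_mat (A - B) = complex_mat A - complex_mat B"
  using assms by (intro eq_matI) auto

theorem lemma3p1:
  fixes n1 n2 m :: nat
    and M D K G F :: "real mat"
    and \<alpha> :: complex
    and b \<kappa> :: "complex vec"
  assumes "0 < n1" and "0 < n2" and "0 < m" and "n2 < n1"
    and "M \<in> carrier_mat n1 n1" and "D \<in> carrier_mat n1 n1" and "K \<in> carrier_mat n1 n1"
    and "G \<in> carrier_mat n2 n1" and "F \<in> carrier_mat n1 m"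
    and "invertible_mat M"
    and "invertible_mat (G * mat_inv M * transpose_mat G)"
    and "b \<in> carrier_vec m"
    and "\<kappa> \<in> carrier_vec n1"
  shows "\<kappa> = transpose_mat (complex_mat (proj_mat M G)) *\<^sub>v \<kappa> \<and>
         (complex_mat (proj_mat M G) * quad_pencil M D K \<alpha>
            * transpose_mat (complex_mat (proj_mat M G))) *\<^sub>v \<kappa>
           = (complex_mat (proj_mat M G) * complex_mat F) *\<^sub>v b
     \<longleftrightarrow>
     (\<exists>\<Lambda> \<in> carrier_vec n2.
        four_block_mat (quad_pencil M D K \<alpha>) (transpose_mat (complex_mat G))
                       (complex_mat G) (0\<^sub>m n2 n2)
          *\<^sub>v (\<kappa> @\<^sub>v \<Lambda>)
        = (complex_mat F *\<^sub>v b) @\<^sub>v 0\<^sub>v n2)"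
proof -
  note M = assms(5) and D = assms(6) and K = assms(7) and G = assms(8) and F = assms(9)
    and b = assms(12) and \<kappa> = assms(13)
  obtain V where V: "V \<in> carrier_mat n2 n1" and VG: "V * transpose_mat G = 1\<^sub>m n2"
    and Pi: "proj_mat M G = 1\<^sub>m n1 - transpose_mat G * V"
    using proj_mat_eq_one_minus_mult[OF M G assms(10,11)] .
  define P where "P = complex_mat (proj_mat M G)"
  define H where "H = transpose_mat (complex_mat G)"
  have GT: "transpose_mat G \<in> carrier_mat n1 n2" using G by simp
  have H: "H \<in> carrier_mat n1 n2" unfolding H_def using G by simp
  have HG: "H = complex_mat (transpose_mat G)" unfolding H_def by (rule map_mat_transpose)
  have VH: "complex_mat V * H = 1\<^sub>m n2"
    unfolding HG using of_real_hom.mat_hom_mult[OF V GT, where 'a = complex] VG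
    by (simp add: of_real_hom.mat_hom_one)
  have P_eq: "P = 1\<^sub>m n1 - H * complex_mat V"
    unfolding P_def Pi HG using GT V
    by (simp add: complex_mat_minus[of _ n1 n1] of_real_hom.mat_hom_one
        of_real_hom.mat_hom_mult[OF GT V])
  have A: "quad_pencil M D K \<alpha> \<in> carrier_mat n1 n1"
    unfolding quad_pencil_def using M D K by simp
  have Fb: "complex_mat F *\<^sub>v b \<in> carrier_vec n1"
    using F b by (intro mult_mat_vec_carrier[of _ n1 m]) simp_all
  have PF: "(P * complex_mat F) *\<^sub>v b = P *\<^sub>v (complex_mat F *\<^sub>v b)"
    using H V F b by (intro assoc_mult_mat_vec[of _ n1 n1 _ m]) (auto simp: P_eq)
  have Gc: "complex_mat G = transpose_mat H" unfolding H_def by simp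
  have Vc: "complex_mat V \<in> carrier_mat n2 n1" using V by simp
  from projected_equation_iff_saddle_point[OF A H Vc VH \<kappa> Fb P_eq]
  show ?thesis unfolding PF[symmetric] unfolding P_def H_def by simp
qed

end
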